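(* Let $A^n$ be a singular Minkowski space and let $\phi\in\partial_c A^n$ be a coarse ideal point. Then $\phi$ is represented by a Busemann function in each of the following two situations: (1) the direction of $\mathrm{Pr}(\phi)$ is regular; (2) $\phi$ is represented as the limiting horofunction of a flag-directed sequence of level 1 with directing flag $(x_0,\bar\alpha_1)$, where the ray $\bar\alpha_1$ has singular direction.
   Context: A singular Minkowski space $A^n$ is an $n$-dimensional real affine space with directing vector space $V^n$ equipped with a strictly convex (not necessarily smooth) norm $\|\cdot\|$; the distance is $|xy|=\|\overrightarrow{xy}\|$. Let $\mathcal S$ be the unit sphere of the norm, and fix an origin $x_0\in A^n$. A direction given by a vector $\vec v\in\mathcal S$ is regular if $\mathcal S$ has a tangent hyperplane at $\vec v$, i.e. its supporting hyperplane at $\vec v$ is unique; otherwise it is singular. A ray is an isometric embedding $[0,+\infty)\to A^n$, i.e. an affine half-line. Coarse boundary: $C(A^n,\mathbb{R})$ is the space of continuous functions with uniform convergence on compact sets, and $C^*(A^n,\mathbb{R})$ is its quotient by constants. For $y\in A^n$ let $d_y(x)=|xy|-|x_0y|$. Identify $A^n$ with the set of classes of the $d_y$ in $C^*(A^n,\mathbb{R})$; then $\partial_cA^n$ is the closure of this set minus the set itself. Functions representing points of $\partial_cA^n$ are called horofunctions; two horofunctions represent the same coarse ideal point iff they differ by a constant. The limiting horofunction of a sequence $\{x_k\}$ is $\lim_{k\to\infty} d_{x_k}$. The Busemann function of a ray $c$ is $\beta_c(y)=\lim_{t\to+\infty}(|yc(t)|-t)$. The weak boundary $\partial_wA^n$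 is the set of equivalence classes of rays at finite Hausdorff distance; in $A^n$ such a class is given by a common direction of rays. The projection $\mathrm{Pr}\colon\partial_cA^n\to\partial_wA^n$ is defined as follows: normalize $\phi$ by $\phi(x_0)=0$; there is a unique ray $c$ with $c(0)=x_0$ such that for each $t>0$ the point $c(t)$ is the unique minimum point of $\phi$ on the closed ball $\mathcal B(x_0,t)$, with minimum value $-t$; $\mathrm{Pr}(\phi)$ is the class of $c$, and the direction of $\mathrm{Pr}(\phi)$ is the direction of $c$. A sequence $\{x_k\}\subset A^n$ is almost flag-directed of level 1 with directing flag $(x_0,\bar\alpha_1)$ if $|x_0x_k|\to+\infty$ and the segments $[x_0x_k]$ converge to the ray $\bar\alpha_1$ from $x_0$ (uniformly on compacts in arc length parameterizations). Let $\alpha_1$ be the line containing $\bar\alpha_1$. The sequence is flag-directed of level 1 if moreover, for a hyperplane $A^{n-1}_1$ transversal to $\alpha_1$, the projections $x_{1,k}$ of $x_k$ to $A_1^{n-1}$ along $\alpha_1$ converge to a point (this does not depend on the choice of the hyperplane). *)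

theory Defs
  imports "HOL-Analysis.Analysis"
begin

text \<open>
  The affine space is modelled by its directing vector space \<^typ>\<open>'a\<close>, with an arbitrary
  point \<open>x0\<close> as origin; the Minkowski norm is the norm of the type.
  Finite-dimensionality is a hypothesis, so no Euclidean structure is involved.
\<close>

definition has_dimension :: "'a::real_vector itself \<Rightarrow> nat \<Rightarrow> bool" where
  "has_dimension TYPE('a::real_vector) n \<longleftrightarrow>
     (\<exists>B::'a set. finite B \<and> card B = n \<and> independent B \<and> span B = UNIV)"

definition strictly_convex_norm :: "'a::real_normed_vector itself \<Rightarrow> bool" where
  "strictly_convex_norm TYPE('a::real_normed_vector) \<longleftrightarrow>
     (\<forall>(u::'a) v t. norm u = 1 \<and> norm v = 1 \<and> u \<noteq> v \<and> 0 < t \<and> t < 1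
        \<longrightarrow> norm ((1 - t) *\<^sub>R u + t *\<^sub>R v) < 1)"

definition singular_minkowski_space :: "'a::real_normed_vector itself \<Rightarrow> nat \<Rightarrow> bool" where
  "singular_minkowski_space T n \<longleftrightarrow> has_dimension T n \<and> strictly_convex_norm T"


section \<open>Regular and singular directions\<close>

definition is_hyperplane :: "'a::real_vector set \<Rightarrow> bool" where
  "is_hyperplane H \<longleftrightarrow>
     (\<exists>(f::'a \<Rightarrow> real) b. linear f \<and> (\<exists>u. f u \<noteq> 0) \<and> H = {x. f x = b})"

text \<open>Replacing \<open>(f, b)\<close> by \<open>(-f, -b)\<close> if necessary, the half-space bounded by the hyperplane
  that contains the unit sphere may be taken to be \<open>f \<le> b\<close>.\<close>

definition supporting_hyperplane_at :: "'a::real_normed_vector \<Rightarrow> 'a set \<Rightarrow> bool" where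
  "supporting_hyperplane_at v H \<longleftrightarrow>
     (\<exists>(f::'a \<Rightarrow> real) b. linear f \<and> (\<exists>u. f u \<noteq> 0) \<and> H = {x. f x = b}
        \<and> v \<in> H \<and> sphere 0 1 \<subseteq> {x. f x \<le> b})"

definition regular_direction :: "'a::real_normed_vector \<Rightarrow> bool" where
  "regular_direction v \<longleftrightarrow> v \<in> sphere 0 1 \<and> (\<exists>!H. supporting_hyperplane_at v H)"

definition singular_direction :: "'a::real_normed_vector \<Rightarrow> bool" where
  "singular_direction v \<longleftrightarrow> v \<in> sphere 0 1 \<and> \<not> (\<exists>!H. supporting_hyperplane_at v H)"


section \<open>Rays and the weak boundary\<close>

text \<open>Rays are total functions of which only the values on \<open>{0..}\<close> matter.\<close>

definition is_ray :: "(real \<Rightarrow> 'a::metric_space) \<Rightarrow> bool" where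
  "is_ray c \<longleftrightarrow> (\<forall>s\<ge>0. \<forall>t\<ge>0. dist (c s) (c t) = \<bar>s - t\<bar>)"

text \<open>For a strictly convex norm a ray satisfies \<open>c t = c 0 + t *\<^sub>R v\<close> for \<open>t \<ge> 0\<close>,
  and its direction \<open>v\<close> is \<open>c 1 - c 0\<close>.\<close>

definition ray_direction :: "(real \<Rightarrow> 'a::real_normed_vector) \<Rightarrow> 'a" where
  "ray_direction c = c 1 - c 0"

definition finite_Hausdorff_distance :: "'a::metric_space set \<Rightarrow> 'a set \<Rightarrow> bool" where
  "finite_Hausdorff_distance S T \<longleftrightarrow>
     (\<exists>r. (\<forall>x\<in>S. \<exists>y\<in>T. dist x y \<le> r) \<and> (\<forall>y\<in>T. \<exists>x\<in>S. dist x y \<le> r))"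

definition weak_rel :: "((real \<Rightarrow> 'a::metric_space) \<times> (real \<Rightarrow> 'a)) set" where
  "weak_rel = {(c, c'). is_ray c \<and> is_ray c'
                 \<and> finite_Hausdorff_distance (c ` {0..}) (c' ` {0..})}"

definition weak_boundary :: "(real \<Rightarrow> 'a::metric_space) set set" where
  "weak_boundary = {c. is_ray c} // weak_rel"

definition weak_direction :: "(real \<Rightarrow> 'a::real_normed_vector) set \<Rightarrow> 'a" where
  "weak_direction P = (THE v. \<exists>c\<in>P. v = ray_direction c)"


section \<open>The coarse boundary\<close>

definition cont_funs :: "('a::metric_space \<Rightarrow> real) set" where
  "cont_funs = {f. continuous_on UNIV f}"

text \<open>The topology of uniform convergence on compact sets.\<close>

definition cont_topology :: "('a::metric_space \<Rightarrow> real) topology" where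
  "cont_topology = topology_generated_by
     {{g \<in> cont_funs. \<forall>x\<in>K. \<bar>g x - f x\<bar> < e} | f K e.
        f \<in> cont_funs \<and> compact K \<and> (0::real) < e}"

definition coarse_rel :: "(('a::metric_space \<Rightarrow> real) \<times> ('a \<Rightarrow> real)) set" where
  "coarse_rel = {(f, g). f \<in> cont_funs \<and> g \<in> cont_funs \<and> (\<exists>a. \<forall>x. g x = f x + a)}"

definition coarse_class :: "('a::metric_space \<Rightarrow> real) \<Rightarrow> ('a \<Rightarrow> real) set" where
  "coarse_class f = coarse_rel `` {f}"

definition coarse_topology :: "('a::metric_space \<Rightarrow> real) set topology" where
  "coarse_topology = topology (\<lambda>U. U \<subseteq> cont_funs // coarse_rel
     \<and> openin cont_topology {f \<in> cont_funs. coarse_class f \<in> U})"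

definition dist_fun :: "'a::metric_space \<Rightarrow> 'a \<Rightarrow> 'a \<Rightarrow> real" where
  "dist_fun x0 y x = dist x y - dist x0 y"

definition coarse_points :: "'a::metric_space \<Rightarrow> ('a \<Rightarrow> real) set set" where
  "coarse_points x0 = (\<lambda>y. coarse_class (dist_fun x0 y)) ` UNIV"

definition coarse_boundary :: "'a::metric_space \<Rightarrow> ('a \<Rightarrow> real) set set" where
  "coarse_boundary x0 = (coarse_topology closure_of coarse_points x0) - coarse_points x0"

definition is_limiting_horofunction ::
    "'a::metric_space \<Rightarrow> (nat \<Rightarrow> 'a) \<Rightarrow> ('a \<Rightarrow> real) \<Rightarrow> bool" where
  "is_limiting_horofunction x0 X h \<longleftrightarrow>
     limitin cont_topology (\<lambda>k. dist_fun x0 (X k)) h sequentially"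

definition busemann :: "(real \<Rightarrow> 'a::metric_space) \<Rightarrow> 'a \<Rightarrow> real" where
  "busemann c y = Lim at_top (\<lambda>t. dist y (c t) - t)"

definition minimizing_ray ::
    "'a::metric_space \<Rightarrow> ('a \<Rightarrow> real) \<Rightarrow> (real \<Rightarrow> 'a) \<Rightarrow> bool" where
  "minimizing_ray x0 h c \<longleftrightarrow> is_ray c \<and> c 0 = x0 \<and>
     (\<forall>t>0. c t \<in> cball x0 t \<and> h (c t) = - t \<and> (\<forall>y \<in> cball x0 t. y \<noteq> c t \<longrightarrow> h (c t) < h y))"

definition Pr :: "'a::metric_space \<Rightarrow> ('a \<Rightarrow> real) set \<Rightarrow> (real \<Rightarrow> 'a) set" where
  "Pr x0 \<Phi> = (THE P. \<exists>h\<in>\<Phi>. \<exists>c. h x0 = 0 \<and> minimizing_ray x0 h c \<and> P = weak_rel `` {c})"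


section \<open>Flag-directed sequences of level 1\<close>

text \<open>Arc length parameterization of the segment from \<open>x\<close> to \<open>y\<close>, constant after its end.\<close>

definition arc_segment :: "'a::real_normed_vector \<Rightarrow> 'a \<Rightarrow> real \<Rightarrow> 'a" where
  "arc_segment x y s = x + min s (dist x y) *\<^sub>R sgn (y - x)"

definition almost_flag_directed1 ::
    "'a::real_normed_vector \<Rightarrow> (real \<Rightarrow> 'a) \<Rightarrow> (nat \<Rightarrow> 'a) \<Rightarrow> bool" where
  "almost_flag_directed1 x0 \<alpha> X \<longleftrightarrow> is_ray \<alpha> \<and> \<alpha> 0 = x0
     \<and> filterlim (\<lambda>k. dist x0 (X k)) at_top sequentially
     \<and> (\<forall>K. compact K \<and> K \<subseteq> {0..} \<longrightarrow>
          uniform_limit K (\<lambda>k. arc_segment x0 (X k)) \<alpha> sequentially)"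

definition transversal :: "'a set \<Rightarrow> 'a set \<Rightarrow> bool" where
  "transversal H L \<longleftrightarrow> (\<exists>p. H \<inter> L = {p})"

definition projection_along :: "'a::real_vector set \<Rightarrow> 'a set \<Rightarrow> 'a \<Rightarrow> 'a" where
  "projection_along L H x = (THE y. y \<in> H \<and> (\<exists>p\<in>L. \<exists>q\<in>L. y - x = p - q))"

definition flag_directed1 ::
    "'a::real_normed_vector \<Rightarrow> (real \<Rightarrow> 'a) \<Rightarrow> (nat \<Rightarrow> 'a) \<Rightarrow> bool" where
  "flag_directed1 x0 \<alpha> X \<longleftrightarrow> almost_flag_directed1 x0 \<alpha> X \<and>
     (let L = affine hull (\<alpha> ` {0..}) in
        \<exists>H. is_hyperplane H \<and> transversal H L \<and> convergent (\<lambda>k. projection_along L H (X k)))"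


section \<open>Basic properties of the topologies\<close>

lemma topspace_cont_topology:
  "topspace cont_topology = (cont_funs :: ('a::metric_space \<Rightarrow> real) set)"
proof -
  have "f \<in> topspace cont_topology" if "f \<in> cont_funs" for f :: "'a \<Rightarrow> real"
  proof -
    have "{g \<in> cont_funs. \<forall>x\<in>{}. \<bar>g x - f x\<bar> < 1}
            \<in> {{g \<in> cont_funs. \<forall>x\<in>K. \<bar>g x - f x\<bar> < e} | f K e.
                 f \<in> cont_funs \<and> compact K \<and> (0::real) < e}"
      using that by (intro CollectI exI[of _ f] exI[of _ "{}"] exI[of _ 1]) auto
    then show ?thesis
      using that unfolding cont_topology_def topology_generated_by_topspace by blast
  qed
  then show ?thesis
    unfolding cont_topology_def topology_generated_by_topspace by auto
qed

lemma openin_coarse_topology: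
  fixes U :: "('a::metric_space \<Rightarrow> real) set set"
  shows "openin coarse_topology U \<longleftrightarrow>
     U \<subseteq> cont_funs // coarse_rel \<and> openin cont_topology {f \<in> cont_funs. coarse_class f \<in> U}"
proof -
  have "istopology (\<lambda>U :: ('a \<Rightarrow> real) set set. U \<subseteq> cont_funs // coarse_rel
          \<and> openin cont_topology {f \<in> cont_funs. coarse_class f \<in> U})"
    unfolding istopology_def
  proof (intro conjI allI impI)
    fix S T :: "('a \<Rightarrow> real) set set"
    assume S: "S \<subseteq> cont_funs // coarse_rel
            \<and> openin cont_topology {f \<in> cont_funs. coarse_class f \<in> S}"
      and T: "T \<subseteq> cont_funs // coarse_rel
            \<and> openin cont_topology {f \<in> cont_funs. coarse_class f \<in> T}"
    show "S \<inter> T \<subseteq> cont_funs // coarse_rel" using S by blast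
    have "{f \<in> cont_funs. coarse_class f \<in> S \<inter> T}
        = {f \<in> cont_funs. coarse_class f \<in> S} \<inter> {f \<in> cont_funs. coarse_class f \<in> T}" by blast
    then show "openin cont_topology {f \<in> cont_funs. coarse_class f \<in> S \<inter> T}"
      using S T by (simp add: openin_Int)
  next
    fix \<K> :: "('a \<Rightarrow> real) set set set"
    assume K: "\<forall>S\<in>\<K>. S \<subseteq> cont_funs // coarse_rel
            \<and> openin cont_topology {f \<in> cont_funs. coarse_class f \<in> S}"
    show "\<Union>\<K> \<subseteq> cont_funs // coarse_rel" using K by blast
    have "{f \<in> cont_funs. coarse_class f \<in> \<Union>\<K>}
        = \<Union>((\<lambda>S. {f \<in> cont_funs. coarse_class f \<in> S}) ` \<K>)" by blast
    then show "openin cont_topology {f \<in> cont_funs. coarse_class f \<in> \<Union>\<K>}"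
      using K by (auto intro!: openin_Union)
  qed
  then show ?thesis
    unfolding coarse_topology_def by (simp add: topology_inverse')
qed

lemma topspace_coarse_topology:
  "topspace coarse_topology = (cont_funs // coarse_rel :: ('a::metric_space \<Rightarrow> real) set set)"
proof -
  have "{f \<in> cont_funs. coarse_class f \<in> cont_funs // coarse_rel} = (cont_funs :: ('a \<Rightarrow> real) set)"
    by (auto simp: quotient_def coarse_class_def)
  then have "openin coarse_topology (cont_funs // coarse_rel :: ('a \<Rightarrow> real) set set)"
    unfolding openin_coarse_topology by (metis openin_topspace order_refl topspace_cont_topology)
  then show ?thesis
    by (meson openin_coarse_topology openin_subset openin_topspace subset_antisym)
qed

lemma quotient_map_coarse_class: "quotient_map cont_topology coarse_topology coarse_class"
  unfolding quotient_map_def topspace_cont_topology topspace_coarse_topology openin_coarse_topology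
  by (auto simp: quotient_def coarse_class_def)

end

theory Submission
  imports Defs
begin

text \<open>
  Write \<open>c(t) = x0 + t v\<close>. The Busemann function of \<open>c\<close> at \<open>x\<close> is the infimum over \<open>t \<ge> 0\<close> of
  \<open>|x - c(t)| - t\<close>, because this expression decreases with \<open>t\<close>. The same formula, for an
  arbitrary sublinear function in place of the norm, is the elementary step of the Hahn--Banach
  theorem: it makes the function smaller, keeps it sublinear, and makes it linear along \<open>v\<close>.
  The function \<open>asymptote\<close> plays both parts.

  Regular direction. A coarse ideal point contains a function \<open>h\<close> that is the pointwise limit of
  normalised distance functions from points going to infinity. Hence \<open>h\<close> is 1-Lipschitz and
  midpoint convex, vanishes at \<open>x0\<close>, and equals \<open>- t\<close> at \<open>c(t)\<close> for some unit vector \<open>v\<close>, which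
  is the direction of the projection to the weak boundary. The Lipschitz bound from \<open>c(t)\<close>
  gives \<open>h \<le> \<beta>\<close>, where \<open>\<beta>\<close> is the Busemann function of \<open>c\<close>. Every linear minorant of \<open>\<beta>\<close>
  (with \<open>x0\<close> as origin) is the negative of a supporting functional of the unit ball at \<open>v\<close>; if
  \<open>v\<close> is regular there is only one, and the Hahn--Banach theorem forces \<open>\<beta>\<close> to be equal to it.
  A midpoint convex function below a linear one that agrees with it at the origin is that linear
  function, so \<open>h = \<beta>\<close> (\<open>horofunction_eq_busemann_of_regular\<close>).

  Flag-directed sequence of level 1. Its members are \<open>X k = P k + s k v\<close> with \<open>P k\<close> convergent to
  a point \<open>p\<close> and \<open>s k\<close> tending to infinity (\<open>flag_directed1_decomposition\<close>). Replacing
  \<open>X k\<close> by the point \<open>p + s k v\<close> of a ray changes distances by at most \<open>|P k - p|\<close>, which tends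
  to zero, so the limiting horofunction is the Busemann function of the ray from \<open>p\<close> in direction
  \<open>v\<close>, up to a constant (\<open>limiting_horofunction_flag_directed1\<close>).
\<close>

section \<open>Finite-dimensional normed spaces\<close>

text \<open>
  By induction on the spanning set. If \<open>b\<close> is outside the span of \<open>B\<close>, which is closed by the
  induction hypothesis, it has positive distance \<open>d\<close> from it, and so \<open>norm (s *\<^sub>R b + w) \<ge> \<bar>s\<bar> * d\<close>
  for \<open>w\<close> in the span. Thus both coordinates of a bounded set range over compact sets.
\<close>

lemma compact_cball_Int_span:
  fixes B :: "'a::real_normed_vector set"
  assumes "finite B"
  shows "compact (cball 0 r \<inter> span B)"
  using assms
proof (induction B arbitrary: r rule: finite_induct)
  case empty
  have "finite (cball 0 r \<inter> span ({} :: 'a set))"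
    by (rule finite_subset[of _ "{0}"]) auto
  then show ?case by (rule finite_imp_compact)
next
  case (insert b B)
  show ?case
  proof (cases "b \<in> span B")
    case True
    then show ?thesis using insert.IH by (simp add: span_redundant)
  next
    case False
    have "closed (span B)"
    unfolding closed_sequential_limits
    proof (intro allI impI, elim conjE)
      fix f l assume f: "\<forall>n. f n \<in> span B" and l: "f \<longlonglongrightarrow> l"
      obtain R where R: "\<And>k. norm (f k) \<le> R"
        using convergent_imp_Bseq[of f] l by (auto simp: convergent_def elim!: BseqE)
      have "closed (cball 0 R \<inter> span B)"
        by (intro compact_imp_closed insert.IH)
      then show "l \<in> span B"
        using closed_sequentially[of _ f l] f l R by (metis IntD2 IntI mem_cball_0)
    qed
    define d where "d = infdist b (span B)"
    have "0 < d"
      using in_closed_iff_infdist_zero[OF \<open>closed (span B)\<close>, of b] False infdist_nonneg[of b "span B"]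
        span_zero[of B] unfolding d_def by (metis empty_iff less_eq_real_def)
    let ?C = "(\<lambda>(s, w). s *\<^sub>R b + w) ` ({- (r / d)..r / d} \<times> (cball 0 (r + r / d * norm b) \<inter> span B))"
    have "compact ?C"
      by (intro compact_continuous_image compact_Times insert.IH compact_Icc)
        (auto simp: case_prod_beta intro!: continuous_intros)
    moreover have "cball 0 r \<inter> span (insert b B) = cball 0 r \<inter> ?C"
    proof (intro equalityI subsetI)
      fix x assume x: "x \<in> cball 0 r \<inter> span (insert b B)"
      then obtain s where w: "x - s *\<^sub>R b \<in> span B"
        by (auto simp: span_breakdown_eq)
      have "\<bar>s\<bar> * d \<le> norm x"
      proof (cases "s = 0")
        case False
        have "(- 1 / s) *\<^sub>R (x - s *\<^sub>R b) \<in> span B" using w by (rule span_scale)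
        then have "d \<le> dist b ((- 1 / s) *\<^sub>R (x - s *\<^sub>R b))"
          unfolding d_def by (rule infdist_le)
        also have "\<dots> = norm ((1 / s) *\<^sub>R x)"
          using False by (simp add: dist_norm algebra_simps)
        finally show ?thesis using False by (simp add: field_simps)
      qed simp
      then have s: "\<bar>s\<bar> \<le> r / d"
        using x \<open>0 < d\<close> by (simp add: field_simps)
      have "norm (x - s *\<^sub>R b) \<le> norm x + \<bar>s\<bar> * norm b"
        using norm_triangle_ineq4[of x "s *\<^sub>R b"] by simp
      also have "\<dots> \<le> r + r / d * norm b"
        using x s by (intro add_mono mult_right_mono) auto
      finally have "(s, x - s *\<^sub>R b) \<in> {- (r / d)..r / d} \<times> (cball 0 (r + r / d * norm b) \<inter> span B)"
        using s w by auto
      from imageI[OF this, of "\<lambda>(s, w). s *\<^sub>R b + w"] show "x \<in> cball 0 r \<inter> ?C"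
        using x by simp
    next
      fix x assume x: "x \<in> cball 0 r \<inter> ?C"
      then obtain s w where "w \<in> span B" "x = s *\<^sub>R b + w" by auto
      then have "x - s *\<^sub>R b \<in> span B" by simp
      then show "x \<in> cball 0 r \<inter> span (insert b B)"
        using x by (auto simp: span_breakdown_eq)
    qed
    ultimately show ?thesis by (simp add: closed_Int_compact)
  qed
qed

lemma compact_cball_of_dimension:
  fixes a :: "'a::real_normed_vector"
  assumes "has_dimension TYPE('a) n"
  shows "compact (cball a r)"
proof -
  obtain B :: "'a set" where "finite B" "span B = UNIV"
    using assms by (auto simp: has_dimension_def)
  then have "compact (cball (0::'a) r)"
    using compact_cball_Int_span[of B r] by simp
  then have "compact ((+) a ` cball 0 r)" by (rule compact_translation)
  then show ?thesis by (simp flip: cball_translation)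
qed


section \<open>Sublinear functions and supporting functionals\<close>

definition sublinear :: "('a::real_vector \<Rightarrow> real) \<Rightarrow> bool" where
  "sublinear p \<longleftrightarrow> (\<forall>x y. p (x + y) \<le> p x + p y) \<and> (\<forall>x. \<forall>s>0. p (s *\<^sub>R x) = s * p x)"

lemma sublinearD:
  assumes "sublinear p"
  shows "p (x + y) \<le> p x + p y" and "0 \<le> s \<Longrightarrow> p (s *\<^sub>R x) = s * p x" and "p 0 = 0"
    and "0 \<le> p x + p (- x)"
proof -
  show add: "p (x + y) \<le> p x + p y" for x y using assms by (simp add: sublinear_def)
  have "p (2 *\<^sub>R 0) = 2 * p 0" using assms unfolding sublinear_def by (metis zero_less_numeral)
  then show zero: "p 0 = 0" by simp
  show "0 \<le> s \<Longrightarrow> p (s *\<^sub>R x) = s * p x"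
    using assms zero unfolding sublinear_def by (cases "s = 0") auto
  show "0 \<le> p x + p (- x)" using add[of x "- x"] zero by simp
qed

lemma sublinear_norm: "sublinear norm"
  by (simp add: sublinear_def norm_triangle_ineq)

text \<open>
  For \<open>p\<close> the norm and \<open>b = - v\<close> with \<open>norm v = 1\<close> this is the Busemann function of the ray
  from the origin in direction \<open>v\<close>.
\<close>

definition asymptote :: "('a::real_vector \<Rightarrow> real) \<Rightarrow> 'a \<Rightarrow> 'a \<Rightarrow> real" where
  "asymptote p b x = (INF t\<in>{0..}. p (x + t *\<^sub>R b) - t * p b)"

lemma asymptote_lower_bound:
  assumes "sublinear p" "0 \<le> t"
  shows "- p (- x) \<le> p (x + t *\<^sub>R b) - t * p b"
  using sublinearD(1)[OF assms(1), of "x + t *\<^sub>R b" "- x"] sublinearD(2)[OF assms, of b] by simp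

lemma asymptote_le:
  assumes "sublinear p" "0 \<le> t"
  shows "asymptote p b x \<le> p (x + t *\<^sub>R b) - t * p b"
  unfolding asymptote_def
  by (rule cINF_lower) (use assms asymptote_lower_bound in \<open>auto intro!: bdd_belowI2\<close>)

lemma asymptote_approx:
  assumes "sublinear p" "0 < e"
  obtains t where "0 \<le> t" "p (x + t *\<^sub>R b) - t * p b < asymptote p b x + e"
proof -
  have "bdd_below ((\<lambda>t. p (x + t *\<^sub>R b) - t * p b) ` {0..})"
    using assms asymptote_lower_bound by (auto intro!: bdd_belowI2)
  then have "\<exists>t\<in>{0..}. p (x + t *\<^sub>R b) - t * p b < asymptote p b x + e"
    using assms(2) unfolding asymptote_def by (subst cINF_less_iff[symmetric]) auto
  then show ?thesis using that by auto
qed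

lemma sublinear_asymptote:
  assumes p: "sublinear p"
  shows "sublinear (asymptote p b)"
  unfolding sublinear_def
proof (intro conjI allI impI)
  fix x y
  show "asymptote p b (x + y) \<le> asymptote p b x + asymptote p b y"
  proof (rule field_le_epsilon)
    fix e :: real assume "0 < e"
    then have e2: "0 < e / 2" by simp
    obtain s where s: "0 \<le> s" "p (x + s *\<^sub>R b) - s * p b < asymptote p b x + e / 2"
      using asymptote_approx[OF p e2] by metis
    obtain t where t: "0 \<le> t" "p (y + t *\<^sub>R b) - t * p b < asymptote p b y + e / 2"
      using asymptote_approx[OF p e2] by metis
    have "asymptote p b (x + y) \<le> p ((x + s *\<^sub>R b) + (y + t *\<^sub>R b)) - (s + t) * p b"
      using asymptote_le[OF p, of "s + t" b "x + y"] s t by (simp add: algebra_simps)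
    also have "\<dots> \<le> (p (x + s *\<^sub>R b) - s * p b) + (p (y + t *\<^sub>R b) - t * p b)"
      using sublinearD(1)[OF p, of "x + s *\<^sub>R b" "y + t *\<^sub>R b"] by (simp add: algebra_simps)
    finally show "asymptote p b (x + y) \<le> asymptote p b x + asymptote p b y + e"
      using s t by simp
  qed
next
  have le: "asymptote p b (s *\<^sub>R x) \<le> s * asymptote p b x" if "0 < s" for x s
  proof (rule field_le_epsilon)
    fix e :: real assume "0 < e"
    then have "0 < e / s" using that by simp
    then obtain t where t: "0 \<le> t" "p (x + t *\<^sub>R b) - t * p b < asymptote p b x + e / s"
      using asymptote_approx[OF p] by metis
    have "asymptote p b (s *\<^sub>R x) \<le> p (s *\<^sub>R (x + t *\<^sub>R b)) - (s * t) * p b"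
      using asymptote_le[OF p, of "s * t" b "s *\<^sub>R x"] t that by (simp add: algebra_simps)
    also have "\<dots> = s * (p (x + t *\<^sub>R b) - t * p b)"
      using sublinearD(2)[OF p, of s "x + t *\<^sub>R b"] that by (simp add: algebra_simps)
    also have "\<dots> \<le> s * (asymptote p b x + e / s)"
      using t that by (intro mult_left_mono) auto
    finally show "asymptote p b (s *\<^sub>R x) \<le> s * asymptote p b x + e"
      using that by (simp add: algebra_simps)
  qed
  fix x s assume s: "0 < (s::real)"
  have "s * asymptote p b ((1 / s) *\<^sub>R (s *\<^sub>R x)) \<le> s * ((1 / s) * asymptote p b (s *\<^sub>R x))"
    using s by (intro mult_left_mono le) auto
  then have "s * asymptote p b x \<le> asymptote p b (s *\<^sub>R x)" using s by simp
  with le[OF s, of x] show "asymptote p b (s *\<^sub>R x) = s * asymptote p b x" by simp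
qed

lemma asymptote_le_self: "sublinear p \<Longrightarrow> asymptote p b x \<le> p x"
  using asymptote_le[of p 0 b x] by simp

lemma asymptote_minus_le: "sublinear p \<Longrightarrow> asymptote p b (- b) \<le> - p b"
  using asymptote_le[of p 1 b "- b"] by (simp add: sublinearD)

text \<open>
  A sublinear function satisfies \<open>0 \<le> q x + q (- x)\<close>, so this is the set where it behaves like a
  linear function.
\<close>

definition linearity_set :: "('a::real_vector \<Rightarrow> real) \<Rightarrow> 'a set" where
  "linearity_set q = {x. q x + q (- x) = 0}"

lemma subspace_linearity_set:
  assumes q: "sublinear q"
  shows "subspace (linearity_set q)"
proof (rule subspaceI)
  show "0 \<in> linearity_set q" using sublinearD(3)[OF q] by (simp add: linearity_set_def)
next
  fix x y assume "x \<in> linearity_set q" "y \<in> linearity_set q"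
  then show "x + y \<in> linearity_set q"
    using sublinearD(1)[OF q, of x y] sublinearD(1)[OF q, of "- x" "- y"] sublinearD(4)[OF q, of "x + y"]
    by (simp add: linearity_set_def)
next
  fix c x assume x: "x \<in> linearity_set q"
  then have eq: "q x = - q (- x)" by (simp add: linearity_set_def)
  show "c *\<^sub>R x \<in> linearity_set q"
  proof (cases "0 \<le> c")
    case True
    then show ?thesis
      using sublinearD(2)[OF q, of c x] sublinearD(2)[OF q, of c "- x"] eq by (simp add: linearity_set_def)
  next
    case False
    then show ?thesis
      using sublinearD(2)[OF q, of "- c" x] sublinearD(2)[OF q, of "- c" "- x"] eq
      by (simp add: linearity_set_def)
  qed
qed

lemma linear_if_linearity_set_UNIV:
  assumes q: "sublinear q" and "linearity_set q = UNIV"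
  shows "linear q"
proof (rule linearI)
  have neg: "q (- x) = - q x" for x
    using assms(2) by (auto simp: linearity_set_def set_eq_iff eq_neg_iff_add_eq_0 add.commute)
  show "q (x + y) = q x + q y" for x y
    using sublinearD(1)[OF q, of x y] sublinearD(1)[OF q, of "- x" "- y"] neg[of "x + y"] neg[of x]
      neg[of y] by simp
  show "q (r *\<^sub>R x) = r *\<^sub>R q x" for r x
    using sublinearD(2)[OF q, of r x] sublinearD(2)[OF q, of "- r" x] neg[of "r *\<^sub>R x"]
    by (cases "0 \<le> r") auto
qed

lemma linearity_set_mono:
  assumes "sublinear q" "\<And>x. q x \<le> p x"
  shows "linearity_set p \<subseteq> linearity_set q"
proof
  fix x assume "x \<in> linearity_set p"
  then show "x \<in> linearity_set q"
    using assms(2)[of x] assms(2)[of "- x"] sublinearD(4)[OF assms(1), of x]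
    by (simp add: linearity_set_def)
qed

lemma mem_linearity_set_asymptote:
  assumes "sublinear p"
  shows "b \<in> linearity_set (asymptote p b)"
  using asymptote_le_self[OF assms, of b b] asymptote_minus_le[OF assms, of b]
    sublinearD(4)[OF sublinear_asymptote[OF assms, of b], of b]
  by (simp add: linearity_set_def)

text \<open>
  Taking asymptotes along the vectors of \<open>B\<close> one after the other: each one adds its vector to the
  linearity set, and the earlier vectors remain there by monotonicity.
\<close>

lemma sublinear_minorant_on_finite:
  assumes "finite B" "sublinear p"
  shows "\<exists>q. sublinear q \<and> (\<forall>x. q x \<le> p x) \<and> B \<subseteq> linearity_set q"
  using assms
proof (induction B rule: finite_induct)
  case empty
  then show ?case by auto
next
  case (insert b B)
  then obtain q where q: "sublinear q" "\<forall>x. q x \<le> p x" "B \<subseteq> linearity_set q" by blast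
  let ?q = "asymptote q b"
  have "B \<subseteq> linearity_set ?q"
    using linearity_set_mono[OF sublinear_asymptote[OF q(1)] asymptote_le_self[OF q(1)]] q(3) by blast
  moreover have "?q x \<le> p x" for x
    using asymptote_le_self[OF q(1)] q(2) order_trans by blast
  ultimately show ?case
    using sublinear_asymptote[OF q(1)] mem_linearity_set_asymptote[OF q(1)] by (intro exI[of _ ?q]) simp
qed

text \<open>
  The first asymptote, along \<open>w\<close>, pins the value at \<open>w\<close>; the following ones, along a basis,
  make the function linear.
\<close>

lemma Hahn_Banach_finite_dimension:
  fixes p :: "'a::real_vector \<Rightarrow> real"
  assumes "has_dimension TYPE('a) n" and p: "sublinear p"
  obtains g where "linear g" "\<And>x. g x \<le> p x" "g w = p w"
proof -
  obtain B :: "'a set" where B: "finite B" "span B = UNIV"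
    using assms by (auto simp: has_dimension_def)
  obtain q where q: "sublinear q" "\<And>x. q x \<le> asymptote p w x" "B \<subseteq> linearity_set q"
    using sublinear_minorant_on_finite[OF B(1) sublinear_asymptote[OF p]] by blast
  have "linearity_set q = UNIV"
    using span_minimal[OF q(3) subspace_linearity_set[OF q(1)]] B(2) by auto
  then have lin: "linear q" by (rule linear_if_linearity_set_UNIV[OF q(1)])
  have le: "q x \<le> p x" for x
    using q(2)[of x] asymptote_le_self[OF p, of w x] by simp
  have "q (- w) \<le> - p w" using q(2)[of "- w"] asymptote_minus_le[OF p, of w] by simp
  then have "q w = p w" using le[of w] linear_neg[OF lin, of w] by simp
  with lin le show ?thesis by (rule that)
qed

text \<open>
  A linear minorant \<open>g\<close> of the Busemann function takes the value \<open>- 1\<close> at \<open>v\<close>, and \<open>- g\<close> is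
  bounded by the norm; its level set at height one therefore supports the unit sphere at \<open>v\<close>.
  Regularity makes the linear minorants that touch the function at \<open>w\<close> and at \<open>- w\<close> coincide.
\<close>

lemma asymptote_norm_odd_of_regular:
  fixes v :: "'a::real_normed_vector"
  assumes dim: "has_dimension TYPE('a) n" and v: "regular_direction v"
  shows "asymptote norm (- v) (- w) = - asymptote norm (- v) w"
proof -
  let ?p = "asymptote norm (- v)"
  have p: "sublinear ?p" by (intro sublinear_asymptote sublinear_norm)
  have nv: "norm v = 1" using v by (simp add: regular_direction_def)
  have sup: "supporting_hyperplane_at v {x. - g x = 1} \<and> g v = - 1"
    if g: "linear g" "\<And>x. g x \<le> ?p x" for g
  proof -
    have "g v \<le> - 1"
      using g(2)[of v] asymptote_minus_le[OF sublinear_norm, of "- v"] nv by simp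
    moreover have "g (- v) \<le> 1"
      using g(2)[of "- v"] asymptote_le_self[OF sublinear_norm, of "- v" "- v"] nv by simp
    ultimately have gv: "g v = - 1" using linear_neg[OF g(1), of v] by simp
    have "- g x \<le> 1" if "norm x = 1" for x
      using g(2)[of "- x"] asymptote_le_self[OF sublinear_norm, of "- v" "- x"] that
        linear_neg[OF g(1), of x] by simp
    moreover have "linear (\<lambda>x. - g x)" using g(1) by (rule linear_compose_neg)
    ultimately have "supporting_hyperplane_at v {x. - g x = 1}"
      unfolding supporting_hyperplane_at_def
      using gv by (intro exI[of _ "\<lambda>x. - g x"] exI[of _ 1] conjI exI[of _ v]) auto
    then show ?thesis using gv by simp
  qed
  obtain g where g: "linear g" "\<And>x. g x \<le> ?p x" "g w = ?p w"
    using Hahn_Banach_finite_dimension[OF dim p] by metis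
  obtain g' where g': "linear g'" "\<And>x. g' x \<le> ?p x" "g' (- w) = ?p (- w)"
    using Hahn_Banach_finite_dimension[OF dim p] by metis
  have eq: "{x. - g x = 1} = {x. - g' x = 1}"
    using sup[OF g(1,2)] sup[OF g'(1,2)] v unfolding regular_direction_def by blast
  have gv: "g v = - 1" "g' v = - 1" using sup[OF g(1,2)] sup[OF g'(1,2)] by auto
  \<comment> \<open>A functional is determined by its level set at height one and its value at one point there:
      slide \<open>w\<close> along \<open>v\<close> into the level set.\<close>
  have "g (w + (1 + g w) *\<^sub>R v) = - 1"
    using gv by (simp add: linear_add[OF g(1)] linear_scale[OF g(1)])
  then have "g' (w + (1 + g w) *\<^sub>R v) = - 1" using eq by (auto simp: set_eq_iff)
  then have "g' w = g w" using gv by (simp add: linear_add[OF g'(1)] linear_scale[OF g'(1)])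
  then show ?thesis using g(3) g'(3) linear_neg[OF g'(1), of w] by simp
qed


section \<open>Rays and Busemann functions\<close>

text \<open>
  For \<open>0 < s < t\<close> the mean velocity over \<open>[0, t]\<close> is a proper convex combination of the mean
  velocities over \<open>[0, s]\<close> and \<open>[s, t]\<close>. All three are unit vectors, so strict convexity makes
  them equal.
\<close>

lemma ray_affine:
  fixes c :: "real \<Rightarrow> 'a::real_normed_vector"
  assumes sc: "strictly_convex_norm TYPE('a)" and c: "is_ray c" and "0 \<le> t"
  shows "c t = c 0 + t *\<^sub>R ray_direction c"
proof -
  have step: "(1 / s) *\<^sub>R (c s - c 0) = (1 / t) *\<^sub>R (c t - c 0)" if "0 < s" "s < t" for s t
  proof -
    let ?u = "(1 / s) *\<^sub>R (c s - c 0)" and ?w = "(1 / (t - s)) *\<^sub>R (c t - c s)"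
    have n: "norm (c s - c 0) = s" "norm (c t - c s) = t - s" "norm (c t - c 0) = t"
      using c that unfolding is_ray_def dist_norm by fastforce+
    have comb: "(1 - (t - s) / t) *\<^sub>R ?u + ((t - s) / t) *\<^sub>R ?w = (1 / t) *\<^sub>R (c t - c 0)"
    proof -
      have "1 - (t - s) / t = s / t" using that by (simp add: field_simps)
      then show ?thesis using that by (simp flip: scaleR_add_right)
    qed
    have "?u = ?w"
    proof (rule ccontr)
      assume "?u \<noteq> ?w"
      moreover have "norm ?u = 1" "norm ?w = 1" using n that by simp_all
      moreover have "0 < (t - s) / t" "(t - s) / t < 1" using that by simp_all
      ultimately have "norm ((1 - (t - s) / t) *\<^sub>R ?u + ((t - s) / t) *\<^sub>R ?w) < 1"
        using sc unfolding strictly_convex_norm_def by blast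
      then show False unfolding comb using n that by simp
    qed
    then show ?thesis using comb by (metis diff_add_cancel scaleR_left.add scaleR_one)
  qed
  consider "t = 0" | "t = 1" | "0 < t" "t < 1" | "1 < t" using \<open>0 \<le> t\<close> by linarith
  then have "c t - c 0 = t *\<^sub>R (c 1 - c 0)"
  proof cases
    case 3
    then have "t *\<^sub>R ((1 / t) *\<^sub>R (c t - c 0)) = t *\<^sub>R (c 1 - c 0)" using step[of t 1] by simp
    then show ?thesis using 3 by simp
  next
    case 4
    then have "t *\<^sub>R ((1 / t) *\<^sub>R (c t - c 0)) = t *\<^sub>R (c 1 - c 0)" using step[of 1 t] by simp
    then show ?thesis using 4 by simp
  qed auto
  then show ?thesis unfolding ray_direction_def by (simp add: algebra_simps)
qed

lemma norm_ray_direction: "is_ray c \<Longrightarrow> norm (ray_direction c) = 1"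
  unfolding is_ray_def ray_direction_def dist_norm by (metis abs_1 diff_zero zero_le_one order_refl)

lemma is_ray_affine:
  assumes "norm v = 1"
  shows "is_ray (\<lambda>t. p + t *\<^sub>R v)"
  using assms by (simp add: is_ray_def dist_norm flip: scaleR_left_diff_distrib)

text \<open>
  A bound on the Hausdorff distance bounds the difference between the point at time \<open>t\<close> on one
  ray and some point at time \<open>s\<close> on the other. It also bounds \<open>\<bar>t - s\<bar>\<close>, so
  \<open>t * norm (v - v')\<close> stays bounded as \<open>t\<close> grows.
\<close>

lemma weak_rel_same_direction:
  fixes c c' :: "real \<Rightarrow> 'a::real_normed_vector"
  assumes sc: "strictly_convex_norm TYPE('a)" and "(c, c') \<in> weak_rel"
  shows "ray_direction c' = ray_direction c"
proof -
  have c: "is_ray c" and c': "is_ray c'"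
    and "finite_Hausdorff_distance (c ` {0..}) (c' ` {0..})"
    using assms(2) by (auto simp: weak_rel_def)
  then obtain r where r: "\<And>t. 0 \<le> t \<Longrightarrow> \<exists>s\<ge>0. dist (c t) (c' s) \<le> r"
    unfolding finite_Hausdorff_distance_def by fastforce
  let ?v = "ray_direction c" and ?v' = "ray_direction c'"
  note nv = norm_ray_direction[OF c] norm_ray_direction[OF c']
  define R where "R = r + norm (c 0 - c' 0)"
  have bound: "t * norm (?v - ?v') \<le> 2 * R" if t: "0 \<le> t" for t
  proof -
    obtain s where s: "0 \<le> s" "dist (c t) (c' s) \<le> r" using r[OF t] by blast
    have "t *\<^sub>R ?v - s *\<^sub>R ?v' = (c t - c' s) - (c 0 - c' 0)"
      using ray_affine[OF sc c t] ray_affine[OF sc c' s(1)] by simp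
    then have *: "norm (t *\<^sub>R ?v - s *\<^sub>R ?v') \<le> R"
      using norm_triangle_ineq4[of "c t - c' s" "c 0 - c' 0"] s(2) by (simp add: R_def dist_norm)
    have "\<bar>t - s\<bar> \<le> R"
      using norm_triangle_ineq3[of "t *\<^sub>R ?v" "s *\<^sub>R ?v'"] nv t s * by simp
    then have **: "norm ((s - t) *\<^sub>R ?v') \<le> R" using nv by (simp add: abs_minus_commute)
    have "t * norm (?v - ?v') = norm (t *\<^sub>R (?v - ?v'))" using t by simp
    also have "t *\<^sub>R (?v - ?v') = (t *\<^sub>R ?v - s *\<^sub>R ?v') + (s - t) *\<^sub>R ?v'"
      by (simp add: algebra_simps)
    also have "norm \<dots> \<le> 2 * R" using norm_triangle_le[of "t *\<^sub>R ?v - s *\<^sub>R ?v'"] * ** by force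
    finally show ?thesis .
  qed
  have "norm (?v - ?v') = 0"
  proof (rule ccontr)
    assume ne: "norm (?v - ?v') \<noteq> 0"
    define t where "t = (2 * \<bar>R\<bar> + 1) / norm (?v - ?v')"
    have "0 \<le> t" unfolding t_def by simp
    moreover have "t * norm (?v - ?v') = 2 * \<bar>R\<bar> + 1" using ne unfolding t_def by simp
    ultimately show False using bound[of t] by linarith
  qed
  then show ?thesis by simp
qed

lemma busemann_tendsto:
  fixes p v :: "'a::real_normed_vector"
  assumes nv: "norm v = 1"
  shows "((\<lambda>t. dist y (p + t *\<^sub>R v) - t) \<longlongrightarrow> asymptote norm (- v) (y - p)) at_top"
proof (rule order_tendstoI)
  let ?F = "\<lambda>t. norm ((y - p) + t *\<^sub>R (- v)) - t * norm (- v)"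
  have F: "dist y (p + t *\<^sub>R v) - t = ?F t" for t
    using nv by (simp add: dist_norm algebra_simps)
  have decr: "?F t \<le> ?F s" if "s \<le> t" for s t
  proof -
    have "(y - p) + t *\<^sub>R (- v) = ((y - p) + s *\<^sub>R (- v)) + (t - s) *\<^sub>R (- v)"
      by (simp add: algebra_simps)
    then have "norm ((y - p) + t *\<^sub>R (- v)) \<le> norm ((y - p) + s *\<^sub>R (- v)) + norm ((t - s) *\<^sub>R (- v))"
      by (metis norm_triangle_ineq)
    then show ?thesis using that nv by simp
  qed
  fix a
  {
    assume a: "a < asymptote norm (- v) (y - p)"
    show "eventually (\<lambda>t. a < dist y (p + t *\<^sub>R v) - t) at_top"
      using eventually_ge_at_top[of 0]
    proof eventually_elim
      case (elim t)
      then show ?case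
        unfolding F using a asymptote_le[OF sublinear_norm, of t "- v" "y - p"] by linarith
    qed
  next
    assume a: "asymptote norm (- v) (y - p) < a"
    then obtain s where s: "?F s < asymptote norm (- v) (y - p) + (a - asymptote norm (- v) (y - p))"
      using asymptote_approx[OF sublinear_norm, of "a - asymptote norm (- v) (y - p)"] by (metis diff_gt_0_iff_gt)
    show "eventually (\<lambda>t. dist y (p + t *\<^sub>R v) - t < a) at_top"
      using eventually_ge_at_top[of s]
    proof eventually_elim
      case (elim t)
      then show ?case unfolding F using s decr[of s t] by linarith
    qed
  }
qed

lemma busemann_affine_ray:
  assumes "norm v = 1"
  shows "busemann (\<lambda>t. p + t *\<^sub>R v) y = asymptote norm (- v) (y - p)"
  unfolding busemann_def by (intro tendsto_Lim busemann_tendsto[OF assms]) simp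


section \<open>Coarse classes and convergence\<close>

lemma mem_coarse_class_iff:
  assumes "f \<in> cont_funs"
  shows "g \<in> coarse_class f \<longleftrightarrow> (\<exists>a. \<forall>x. g x = f x + a)"
proof
  assume "\<exists>a. \<forall>x. g x = f x + a"
  then obtain a where a: "\<forall>x. g x = f x + a" by blast
  then have "g = (\<lambda>x. f x + a)" by auto
  then have "g \<in> cont_funs" using assms by (auto simp: cont_funs_def intro!: continuous_intros)
  then show "g \<in> coarse_class f" using assms a by (auto simp: coarse_class_def coarse_rel_def)
qed (auto simp: coarse_class_def coarse_rel_def)

lemma coarse_class_eq:
  assumes f: "f \<in> cont_funs" and g: "g \<in> coarse_class f"
  shows "g \<in> cont_funs" "coarse_class g = coarse_class f"
proof -
  show gc: "g \<in> cont_funs" using g by (auto simp: coarse_class_def coarse_rel_def)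
  obtain a where a: "\<forall>x. g x = f x + a" using g mem_coarse_class_iff[OF f] by blast
  have "(\<exists>b. \<forall>x. k x = g x + b) \<longleftrightarrow> (\<exists>b. \<forall>x. k x = f x + b)" for k
  proof
    assume "\<exists>b. \<forall>x. k x = g x + b"
    then obtain b where "\<forall>x. k x = g x + b" by blast
    then show "\<exists>b. \<forall>x. k x = f x + b" using a by (intro exI[of _ "a + b"]) simp
  next
    assume "\<exists>b. \<forall>x. k x = f x + b"
    then obtain b where "\<forall>x. k x = f x + b" by blast
    then show "\<exists>b. \<forall>x. k x = g x + b" using a by (intro exI[of _ "b - a"]) simp
  qed
  then show "coarse_class g = coarse_class f"
    by (auto simp: mem_coarse_class_iff[OF f] mem_coarse_class_iff[OF gc])
qed

lemma dist_fun_in_cont_funs: "dist_fun x0 y \<in> cont_funs"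
  unfolding cont_funs_def dist_fun_def by (auto intro!: continuous_intros)

lemma openin_cont_topology_basic:
  assumes "f \<in> cont_funs" "compact K" "0 < e"
  shows "openin cont_topology {g \<in> cont_funs. \<forall>x\<in>K. \<bar>g x - f x\<bar> < e}"
  unfolding cont_topology_def by (rule topology_generated_by_Basis) (use assms in blast)

lemma limitin_cont_topology_pointwise:
  assumes "limitin cont_topology F h sequentially"
  shows "(\<lambda>k. F k x) \<longlonglongrightarrow> h x"
proof (rule tendstoI)
  fix e :: real assume e: "0 < e"
  have h: "h \<in> cont_funs"
    using assms by (simp add: limitin_def topspace_cont_topology)
  let ?U = "{g \<in> cont_funs. \<forall>y\<in>{x}. \<bar>g y - h y\<bar> < e}"
  have "openin cont_topology ?U" using h e by (intro openin_cont_topology_basic) auto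
  then have "eventually (\<lambda>k. F k \<in> ?U) sequentially"
    by (rule assms[unfolded limitin_def, THEN conjunct2, rule_format, OF conjI]) (use h e in auto)
  then show "eventually (\<lambda>k. dist (F k x) (h x) < e) sequentially"
    by eventually_elim (auto simp: dist_real_def)
qed

text \<open>
  The condition constrains \<open>f\<close> only up to an additive constant, so these sets are preimages of
  open sets of coarse classes. The maximum \<open>M\<close> of the deviation over the compact set leaves a
  margin \<open>e - M\<close>, which is shared between perturbations of \<open>f\<close> on \<open>K\<close> and at \<open>x0\<close>.
\<close>

lemma openin_cont_topology_normalised:
  assumes h: "h \<in> cont_funs" and K: "compact K" and "0 < e"
  shows "openin cont_topology {f \<in> cont_funs. \<forall>x\<in>K. \<bar>f x - f x0 - h x\<bar> < e}" (is "openin _ ?V")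
proof (subst openin_subopen, intro ballI)
  fix f assume f: "f \<in> ?V"
  have cont: "continuous_on K (\<lambda>x. \<bar>f x - f x0 - h x\<bar>)"
    using f h by (auto simp: cont_funs_def intro!: continuous_intros intro: continuous_on_subset)
  obtain M where M: "M < e" "\<forall>x\<in>K. \<bar>f x - f x0 - h x\<bar> \<le> M"
  proof (cases "K = {}")
    case True
    then show ?thesis using that[of 0] \<open>0 < e\<close> by simp
  next
    case False
    then obtain z where "z \<in> K" "\<forall>x\<in>K. \<bar>f x - f x0 - h x\<bar> \<le> \<bar>f z - f x0 - h z\<bar>"
      using continuous_attains_sup[OF K False cont] by blast
    then show ?thesis using f by (intro that[of "\<bar>f z - f x0 - h z\<bar>"]) auto
  qed
  let ?N = "{g \<in> cont_funs. \<forall>x\<in>insert x0 K. \<bar>g x - f x\<bar> < (e - M) / 2}"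
  have "openin cont_topology ?N"
    using f K M by (intro openin_cont_topology_basic) auto
  moreover have "f \<in> ?N" using f M by auto
  moreover have "?N \<subseteq> ?V"
  proof
    fix g assume g: "g \<in> ?N"
    have "\<bar>g x - g x0 - h x\<bar> < e" if "x \<in> K" for x
    proof -
      have "\<bar>g x - f x\<bar> < (e - M) / 2" "\<bar>g x0 - f x0\<bar> < (e - M) / 2" "\<bar>f x - f x0 - h x\<bar> \<le> M"
        using g M that by auto
      moreover have "g x - g x0 - h x = (g x - f x) - (g x0 - f x0) + (f x - f x0 - h x)" by simp
      moreover have "\<bar>(g x - f x) - (g x0 - f x0) + (f x - f x0 - h x)\<bar>
          \<le> \<bar>g x - f x\<bar> + \<bar>g x0 - f x0\<bar> + \<bar>f x - f x0 - h x\<bar>"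
        using abs_triangle_ineq abs_triangle_ineq4 by (meson add_mono_thms_linordered_semiring(3) order_trans)
      ultimately show ?thesis by argo
    qed
    then show "g \<in> ?V" using g by auto
  qed
  ultimately show "\<exists>T. openin cont_topology T \<and> f \<in> T \<and> T \<subseteq> ?V" by blast
qed

lemma approximation_by_dist_fun:
  assumes h: "h \<in> cont_funs" "h x0 = 0"
    and clos: "coarse_class h \<in> coarse_topology closure_of coarse_points x0"
    and "compact K" "0 < e"
  shows "\<exists>y. \<forall>x\<in>K. \<bar>dist_fun x0 y x - h x\<bar> < e"
proof -
  let ?U = "{P \<in> cont_funs // coarse_rel. \<exists>g\<in>P. g x0 = 0 \<and> (\<forall>x\<in>K. \<bar>g x - h x\<bar> < e)}"
  have mem: "coarse_class f \<in> ?U \<longleftrightarrow> (\<forall>x\<in>K. \<bar>f x - f x0 - h x\<bar> < e)" if f: "f \<in> cont_funs" for f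
  proof
    assume "coarse_class f \<in> ?U"
    then obtain g a where g: "\<forall>x. g x = f x + a" "g x0 = 0" "\<forall>x\<in>K. \<bar>g x - h x\<bar> < e"
      using mem_coarse_class_iff[OF f] by blast
    then have "a = - f x0" by simp
    then show "\<forall>x\<in>K. \<bar>f x - f x0 - h x\<bar> < e" using g by simp
  next
    assume *: "\<forall>x\<in>K. \<bar>f x - f x0 - h x\<bar> < e"
    have "(\<lambda>x. f x - f x0) \<in> coarse_class f"
      unfolding mem_coarse_class_iff[OF f] by (intro exI[of _ "- f x0"]) simp
    moreover have "coarse_class f \<in> cont_funs // coarse_rel"
      using f by (auto simp: coarse_class_def quotient_def)
    ultimately show "coarse_class f \<in> ?U"
      using * by (intro CollectI conjI bexI[of _ "\<lambda>x. f x - f x0"]) auto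
  qed
  have "{f \<in> cont_funs. coarse_class f \<in> ?U} = {f \<in> cont_funs. \<forall>x\<in>K. \<bar>f x - f x0 - h x\<bar> < e}"
    using mem by blast
  then have "openin coarse_topology ?U"
    unfolding openin_coarse_topology
    using openin_cont_topology_normalised[OF h(1) \<open>compact K\<close> \<open>0 < e\<close>] by auto
  moreover have "coarse_class h \<in> ?U" using mem[OF h(1)] h(2) \<open>0 < e\<close> by simp
  ultimately have "\<exists>P. P \<in> coarse_points x0 \<and> P \<in> ?U"
    using clos[unfolded in_closure_of, THEN conjunct2, THEN spec, of ?U] by (elim impE) (rule conjI)
  then obtain y where "coarse_class (dist_fun x0 y) \<in> ?U"
    unfolding coarse_points_def by (elim exE conjE imageE) simp
  then have "\<forall>x\<in>K. \<bar>dist_fun x0 y x - dist_fun x0 y x0 - h x\<bar> < e"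
    using mem[OF dist_fun_in_cont_funs] by blast
  then show ?thesis by (intro exI[of _ y]) (simp add: dist_fun_def)
qed


section \<open>Horofunctions\<close>

definition horofunction_along :: "'a::metric_space \<Rightarrow> (nat \<Rightarrow> 'a) \<Rightarrow> ('a \<Rightarrow> real) \<Rightarrow> bool" where
  "horofunction_along x0 Y h \<longleftrightarrow> filterlim (\<lambda>k. dist x0 (Y k)) at_top sequentially
     \<and> (\<forall>x. (\<lambda>k. dist_fun x0 (Y k) x) \<longlonglongrightarrow> h x)"

text \<open>
  Approximation on growing balls, which are compact, gives the sequence. If it had a bounded
  subsequence it would accumulate at a point \<open>y\<close>, and \<open>\<Phi>\<close> would be the class of the distance
  function of \<open>y\<close>, against the definition of the boundary.
\<close>

lemma coarse_boundary_horofunction: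
  fixes x0 :: "'a::real_normed_vector"
  assumes dim: "has_dimension TYPE('a) n" and \<Phi>: "\<Phi> \<in> coarse_boundary x0"
  obtains h Y where "h \<in> cont_funs" "\<Phi> = coarse_class h" "horofunction_along x0 Y h"
proof -
  have clos: "\<Phi> \<in> coarse_topology closure_of coarse_points x0" and not_pt: "\<Phi> \<notin> coarse_points x0"
    using \<Phi> by (auto simp: coarse_boundary_def)
  have "\<Phi> \<in> cont_funs // coarse_rel"
    using clos by (auto simp: in_closure_of topspace_coarse_topology)
  then obtain f where f: "f \<in> cont_funs" "\<Phi> = coarse_class f"
    by (auto simp: quotient_def coarse_class_def)
  define h where "h x = f x - f x0" for x
  have "h \<in> coarse_class f"
    unfolding mem_coarse_class_iff[OF f(1)] h_def by (intro exI[of _ "- f x0"]) simp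
  from coarse_class_eq[OF f(1) this] have h: "h \<in> cont_funs" "\<Phi> = coarse_class h" "h x0 = 0"
    using f(2) by (auto simp: h_def)
  have "\<exists>y. \<forall>x\<in>cball x0 (real m). \<bar>dist_fun x0 y x - h x\<bar> < 1 / real (Suc m)" for m
    using h clos compact_cball_of_dimension[OF dim] by (intro approximation_by_dist_fun) auto
  then obtain Y where Y: "\<And>m x. x \<in> cball x0 (real m) \<Longrightarrow> \<bar>dist_fun x0 (Y m) x - h x\<bar> < 1 / real (Suc m)"
    by metis
  have lim: "(\<lambda>k. dist_fun x0 (Y k) x) \<longlonglongrightarrow> h x" for x
  proof -
    have "(\<lambda>k. dist_fun x0 (Y k) x - h x) \<longlonglongrightarrow> 0"
    proof (rule Lim_null_comparison)
      show "eventually (\<lambda>k. norm (dist_fun x0 (Y k) x - h x) \<le> 1 / real (Suc k)) sequentially"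
        using eventually_ge_at_top[of "nat \<lceil>dist x0 x\<rceil>"]
      proof eventually_elim
        case (elim k)
        then have "x \<in> cball x0 (real k)" by (simp add: nat_le_iff ceiling_le_iff)
        from Y[OF this] show ?case by simp
      qed
      show "(\<lambda>k. 1 / real (Suc k)) \<longlonglongrightarrow> 0" by (rule lim_1_over_n[THEN LIMSEQ_Suc])
    qed
    then show ?thesis by (simp add: LIM_zero_iff)
  qed
  have "filterlim (\<lambda>k. dist x0 (Y k)) at_top sequentially"
  proof (rule ccontr)
    assume "\<not> ?thesis"
    then obtain R where "\<not> eventually (\<lambda>k. R \<le> dist x0 (Y k)) sequentially"
      by (auto simp: filterlim_at_top)
    then have "infinite {k. dist x0 (Y k) < R}"
      by (simp add: eventually_sequentially infinite_nat_iff_unbounded_le not_le)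
    from infinite_enumerate[OF this] obtain r :: "nat \<Rightarrow> nat"
      where r: "strict_mono r" "\<And>k. dist x0 (Y (r k)) < R" by auto
    then have "\<forall>k. (Y \<circ> r) k \<in> cball x0 R" by (simp add: less_imp_le)
    then obtain y r' where r': "strict_mono r'" "((Y \<circ> r) \<circ> r') \<longlonglongrightarrow> y"
      using compact_cball_of_dimension[OF dim, of x0 R] unfolding compact_def by blast
    have "h x = dist_fun x0 y x" for x
    proof (rule LIMSEQ_unique)
      show "(\<lambda>k. dist_fun x0 ((Y \<circ> r \<circ> r') k) x) \<longlonglongrightarrow> h x"
        using LIMSEQ_subseq_LIMSEQ[OF LIMSEQ_subseq_LIMSEQ[OF lim r(1)] r'(1)] by (simp add: o_def)
      show "(\<lambda>k. dist_fun x0 ((Y \<circ> r \<circ> r') k) x) \<longlonglongrightarrow> dist_fun x0 y x"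
        unfolding dist_fun_def by (intro tendsto_intros r'(2))
    qed
    then have "h = dist_fun x0 y" by auto
    then show False using not_pt h(2) by (auto simp: coarse_points_def)
  qed
  with lim have "horofunction_along x0 Y h" by (simp add: horofunction_along_def)
  with h(1,2) show ?thesis by (rule that)
qed

lemma horofunction_base:
  assumes "horofunction_along x0 Y h"
  shows "h x0 = 0"
proof (rule LIMSEQ_unique)
  show "(\<lambda>k. dist_fun x0 (Y k) x0) \<longlonglongrightarrow> h x0"
    using assms by (simp add: horofunction_along_def)
  show "(\<lambda>k. dist_fun x0 (Y k) x0) \<longlonglongrightarrow> 0" by (simp add: dist_fun_def)
qed

lemma horofunction_Lipschitz:
  assumes "horofunction_along x0 Y h"
  shows "h x \<le> h y + dist x y"
proof (rule LIMSEQ_le)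
  show "(\<lambda>k. dist_fun x0 (Y k) x) \<longlonglongrightarrow> h x"
    "(\<lambda>k. dist_fun x0 (Y k) y + dist x y) \<longlonglongrightarrow> h y + dist x y"
    using assms by (auto simp: horofunction_along_def intro!: tendsto_intros)
  show "\<exists>N. \<forall>k\<ge>N. dist_fun x0 (Y k) x \<le> dist_fun x0 (Y k) y + dist x y"
    using dist_triangle[of x _ y] by (auto simp: dist_fun_def algebra_simps)
qed

lemma horofunction_midpoint_convex:
  fixes x0 :: "'a::real_normed_vector"
  assumes "horofunction_along x0 Y h"
  shows "2 * h (midpoint x y) \<le> h x + h y"
proof (rule LIMSEQ_le)
  show "(\<lambda>k. 2 * dist_fun x0 (Y k) (midpoint x y)) \<longlonglongrightarrow> 2 * h (midpoint x y)"
    "(\<lambda>k. dist_fun x0 (Y k) x + dist_fun x0 (Y k) y) \<longlonglongrightarrow> h x + h y"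
    using assms by (auto simp: horofunction_along_def intro!: tendsto_intros)
  have "2 * dist (midpoint x y) z \<le> dist x z + dist y z" for z
  proof -
    have "2 * dist (midpoint x y) z = norm (2 *\<^sub>R (midpoint x y - z))" by (simp add: dist_norm)
    also have "2 *\<^sub>R (midpoint x y - z) = (x - z) + (y - z)"
      by (simp add: midpoint_def algebra_simps scaleR_2)
    also have "norm \<dots> \<le> dist x z + dist y z" by (simp add: dist_norm norm_triangle_ineq)
    finally show ?thesis .
  qed
  then show "\<exists>N. \<forall>k\<ge>N. 2 * dist_fun x0 (Y k) (midpoint x y) \<le> dist_fun x0 (Y k) x + dist_fun x0 (Y k) y"
    by (auto simp: dist_fun_def algebra_simps)
qed

text \<open>
  The vector \<open>v\<close> is the limit, along a subsequence \<open>Z\<close> of \<open>Y\<close>, of the directions \<open>u k\<close> in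
  which the points \<open>Z k\<close> are seen from \<open>x0\<close>: the normalised distance function of \<open>Z k\<close> equals \<open>- t\<close> at
  \<open>x0 + t *\<^sub>R u k\<close> as soon as \<open>Z k\<close> is at distance at least \<open>t\<close>.
\<close>

lemma horofunction_descent_direction:
  fixes x0 :: "'a::real_normed_vector"
  assumes dim: "has_dimension TYPE('a) n" and h: "horofunction_along x0 Y h"
  obtains v where "norm v = 1" "\<And>t. 0 \<le> t \<Longrightarrow> h (x0 + t *\<^sub>R v) = - t"
proof -
  have inf: "filterlim (\<lambda>k. dist x0 (Y k)) at_top sequentially"
    and lim: "\<And>x. (\<lambda>k. dist_fun x0 (Y k) x) \<longlonglongrightarrow> h x"
    using h by (auto simp: horofunction_along_def)
  have "sgn (Y k - x0) \<in> cball 0 1" for k by (simp add: norm_sgn)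
  with compact_cball_of_dimension[OF dim, unfolded compact_def, rule_format]
  obtain v r where r: "strict_mono r" "((\<lambda>k. sgn (Y k - x0)) \<circ> r) \<longlonglongrightarrow> v"
    by metis
  define Z where "Z k = Y (r k)" for k
  define u where "u k = sgn (Z k - x0)" for k
  have u: "u \<longlonglongrightarrow> v" using r(2) unfolding u_def Z_def o_def .
  have Zinf: "filterlim (\<lambda>k. dist x0 (Z k)) at_top sequentially"
    using filterlim_compose[OF inf filterlim_subseq[OF r(1)]] by (simp add: Z_def)
  have "norm v = 1"
  proof (rule LIMSEQ_unique)
    show "(\<lambda>k. norm (u k)) \<longlonglongrightarrow> norm v" using u by (rule tendsto_norm)
    have "eventually (\<lambda>k. norm (u k) = 1) sequentially"
      using Zinf[unfolded filterlim_at_top_dense, rule_format, of 0]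
      by eventually_elim (auto simp: u_def norm_sgn)
    then show "(\<lambda>k. norm (u k)) \<longlonglongrightarrow> 1" by (rule tendsto_eventually)
  qed
  moreover have "h (x0 + t *\<^sub>R v) = - t" if t: "0 \<le> t" for t
  proof (rule LIMSEQ_unique)
    show "(\<lambda>k. dist_fun x0 (Z k) (x0 + t *\<^sub>R v)) \<longlonglongrightarrow> h (x0 + t *\<^sub>R v)"
      using LIMSEQ_subseq_LIMSEQ[OF lim r(1)] by (simp add: o_def Z_def)
    have "(\<lambda>k. dist_fun x0 (Z k) (x0 + t *\<^sub>R v) - (- t)) \<longlonglongrightarrow> 0"
    proof (rule Lim_null_comparison)
      show "eventually (\<lambda>k. norm (dist_fun x0 (Z k) (x0 + t *\<^sub>R v) - (- t)) \<le> norm (t *\<^sub>R (u k - v))) sequentially"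
        using Zinf[unfolded filterlim_at_top, rule_format, of t]
      proof eventually_elim
        case (elim k)
        have "Z k = x0 + dist x0 (Z k) *\<^sub>R u k"
          by (cases "Z k = x0") (auto simp: u_def sgn_div_norm dist_norm norm_minus_commute)
        then have "x0 + t *\<^sub>R u k - Z k = (t - dist x0 (Z k)) *\<^sub>R u k"
          by (metis (no_types, lifting) add_diff_cancel_left scaleR_left_diff_distrib)
        then have "dist (x0 + t *\<^sub>R u k) (Z k) = \<bar>t - dist x0 (Z k)\<bar> * norm (u k)"
          by (simp add: dist_norm)
        also have "\<dots> = dist x0 (Z k) - t"
          using elim t by (cases "Z k = x0") (auto simp: u_def norm_sgn)
        finally have "dist (x0 + t *\<^sub>R u k) (Z k) = dist x0 (Z k) - t" .
        moreover have "\<bar>dist (x0 + t *\<^sub>R v) (Z k) - dist (x0 + t *\<^sub>R u k) (Z k)\<bar>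
            \<le> dist (x0 + t *\<^sub>R v) (x0 + t *\<^sub>R u k)"
          by (metis abs_dist_diff_le dist_commute)
        moreover have "dist (x0 + t *\<^sub>R v) (x0 + t *\<^sub>R u k) = norm (t *\<^sub>R (u k - v))"
          by (simp add: dist_norm norm_minus_commute flip: scaleR_diff_right)
        ultimately show ?case by (simp add: dist_fun_def)
      qed
      have "(\<lambda>k. norm (t *\<^sub>R (u k - v))) \<longlonglongrightarrow> norm (t *\<^sub>R (v - v))"
        by (intro tendsto_intros u)
      then show "(\<lambda>k. norm (t *\<^sub>R (u k - v))) \<longlonglongrightarrow> 0" by simp
    qed
    then show "(\<lambda>k. dist_fun x0 (Z k) (x0 + t *\<^sub>R v)) \<longlonglongrightarrow> - t" by (rule LIM_zero_cancel)
  qed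
  ultimately show ?thesis by (rule that)
qed

lemma norm_midpoint_less:
  fixes a b :: "'a::real_normed_vector"
  assumes "strictly_convex_norm TYPE('a)" "0 < t" "norm a = t" "norm b = t" "a \<noteq> b"
  shows "norm (midpoint a b) < t"
proof -
  have "norm ((1 - 1 / 2) *\<^sub>R ((1 / t) *\<^sub>R a) + (1 / 2) *\<^sub>R ((1 / t) *\<^sub>R b)) < 1"
    by (rule assms(1)[unfolded strictly_convex_norm_def, rule_format]) (use assms in auto)
  also have "(1 - 1 / 2) *\<^sub>R ((1 / t) *\<^sub>R a) + (1 / 2) *\<^sub>R ((1 / t) *\<^sub>R b) = (1 / t) *\<^sub>R midpoint a b"
    by (simp add: midpoint_def scaleR_add_right mult.commute)
  finally show ?thesis using assms(2) by (simp add: field_simps)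
qed

text \<open>
  The Lipschitz bound shows that \<open>- t\<close> is the minimum over the ball of radius \<open>t\<close> and that it
  can only be attained on the boundary sphere. The midpoint of two minimum points would be another
  one, but it lies inside the sphere by strict convexity.
\<close>

lemma minimizing_ray_horofunction:
  fixes x0 :: "'a::real_normed_vector"
  assumes sc: "strictly_convex_norm TYPE('a)" and h: "horofunction_along x0 Y h"
    and v: "norm v = 1" "\<And>t. 0 \<le> t \<Longrightarrow> h (x0 + t *\<^sub>R v) = - t"
  shows "minimizing_ray x0 h (\<lambda>t. x0 + t *\<^sub>R v)"
  unfolding minimizing_ray_def
proof (intro conjI allI impI ballI)
  show "is_ray (\<lambda>t. x0 + t *\<^sub>R v)" using v(1) by (rule is_ray_affine)
  show "x0 + 0 *\<^sub>R v = x0" by simp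
  fix t :: real assume t: "0 < t"
  show "x0 + t *\<^sub>R v \<in> cball x0 t" using v t by (simp add: dist_norm)
  show ht: "h (x0 + t *\<^sub>R v) = - t" using v t by simp
  fix y assume y: "y \<in> cball x0 t" "y \<noteq> x0 + t *\<^sub>R v"
  have lower: "- norm (z - x0) \<le> h z" for z
    using horofunction_Lipschitz[OF h, of x0 z] horofunction_base[OF h]
    by (simp add: dist_norm norm_minus_commute)
  have "- t < h y"
  proof (rule ccontr)
    assume hy: "\<not> - t < h y"
    have "norm (y - x0) = t"
      using lower[of y] hy y(1) by (simp add: dist_norm norm_minus_commute)
    then have "norm (midpoint (y - x0) (t *\<^sub>R v)) < t"
      using v t y by (intro norm_midpoint_less[OF sc]) auto
    moreover have "midpoint (y - x0) (t *\<^sub>R v) = midpoint y (x0 + t *\<^sub>R v) - x0"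
    proof -
      have "(1 / 2) *\<^sub>R x0 + (1 / 2) *\<^sub>R x0 = x0" by (simp flip: scaleR_left_distrib)
      then show ?thesis by (simp add: midpoint_def algebra_simps)
    qed
    ultimately have "- t < h (midpoint y (x0 + t *\<^sub>R v))"
      using lower[of "midpoint y (x0 + t *\<^sub>R v)"] by simp
    then show False
      using horofunction_midpoint_convex[OF h, of y "x0 + t *\<^sub>R v"] ht hy by linarith
  qed
  then show "h (x0 + t *\<^sub>R v) < h y" using ht by simp
qed

lemma weak_direction_weak_class:
  fixes c :: "real \<Rightarrow> 'a::real_normed_vector"
  assumes sc: "strictly_convex_norm TYPE('a)" and c: "is_ray c"
  shows "weak_direction (weak_rel `` {c}) = ray_direction c"
proof -
  have "finite_Hausdorff_distance (c ` {0..}) (c ` {0..})"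
    unfolding finite_Hausdorff_distance_def by (intro exI[of _ 0]) auto
  then have "(c, c) \<in> weak_rel" using c by (simp add: weak_rel_def)
  then show ?thesis
    unfolding weak_direction_def using weak_rel_same_direction[OF sc]
    by (intro the_equality) (blast, metis Image_singleton_iff)
qed

text \<open>
  Minimizing rays are determined by \<open>h\<close> on \<open>{0..}\<close> only; their weak classes agree since the
  Hausdorff distance sees nothing else.
\<close>

lemma Pr_eq_weak_class:
  assumes h: "h \<in> cont_funs" "h x0 = 0" and c: "minimizing_ray x0 h c"
  shows "Pr x0 (coarse_class h) = weak_rel `` {c}"
  unfolding Pr_def
proof (rule the_equality)
  have "h \<in> coarse_class h" unfolding mem_coarse_class_iff[OF h(1)] by (intro exI[of _ 0]) simp
  then show "\<exists>h\<in>coarse_class h. \<exists>c'. h x0 = 0 \<and> minimizing_ray x0 h c' \<and> weak_rel `` {c} = weak_rel `` {c'}"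
    using h c by blast
next
  fix P assume "\<exists>h\<in>coarse_class h. \<exists>c. h x0 = 0 \<and> minimizing_ray x0 h c \<and> P = weak_rel `` {c}"
  then obtain g c' where g: "g \<in> coarse_class h" "g x0 = 0" and c': "minimizing_ray x0 g c'"
    and P: "P = weak_rel `` {c'}" by blast
  obtain a where a: "\<forall>x. g x = h x + a" using g mem_coarse_class_iff[OF h(1)] by blast
  then have "a = 0" using g(2) h(2) by simp
  then have "g = h" using a by auto
  have "c' t = c t" if "0 \<le> t" for t
  proof (cases "t = 0")
    case True
    then show ?thesis using c c' by (simp add: minimizing_ray_def)
  next
    case False
    then show ?thesis using c c' that unfolding \<open>g = h\<close> minimizing_ray_def
      by (metis less_eq_real_def less_irrefl)
  qed
  then have "c' ` {0..} = c ` {0..}" by (intro image_cong) auto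
  then show "P = weak_rel `` {c}"
    using c c' unfolding P weak_rel_def minimizing_ray_def by auto
qed

text \<open>
  The bound \<open>h \<le> \<beta>\<close> by the Busemann function \<open>\<beta>\<close> holds in every direction. For regular \<open>v\<close>,
  \<open>\<beta>\<close> is odd about \<open>x0\<close>, and midpoint convexity of \<open>h\<close> at \<open>x0\<close> turns the upper bound
  at the point opposite to \<open>x\<close> into the lower bound at \<open>x\<close>.
\<close>

lemma horofunction_eq_busemann_of_regular:
  fixes x0 :: "'a::real_normed_vector"
  assumes dim: "has_dimension TYPE('a) n" and h: "horofunction_along x0 Y h"
    and v: "regular_direction v" and desc: "\<And>t. 0 \<le> t \<Longrightarrow> h (x0 + t *\<^sub>R v) = - t"
  shows "h = busemann (\<lambda>t. x0 + t *\<^sub>R v)"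
proof
  fix x
  have nv: "norm v = 1" using v by (simp add: regular_direction_def)
  have le: "h y \<le> asymptote norm (- v) (y - x0)" for y
  proof (rule tendsto_lowerbound)
    show "((\<lambda>t. dist y (x0 + t *\<^sub>R v) - t) \<longlongrightarrow> asymptote norm (- v) (y - x0)) at_top"
      using nv by (rule busemann_tendsto)
    show "eventually (\<lambda>t. h y \<le> dist y (x0 + t *\<^sub>R v) - t) at_top"
      using eventually_ge_at_top[of 0]
    proof eventually_elim
      case (elim t)
      then show ?case using horofunction_Lipschitz[OF h, of y "x0 + t *\<^sub>R v"] desc[of t] by simp
    qed
  qed simp
  let ?y = "x0 - (x - x0)"
  have "midpoint x ?y = x0"
    by (simp add: midpoint_def flip: scaleR_left_distrib)
  then have "0 \<le> h x + h ?y"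
    using horofunction_midpoint_convex[OF h, of x ?y] horofunction_base[OF h] by simp
  moreover have "h ?y \<le> - asymptote norm (- v) (x - x0)"
    using le[of ?y] asymptote_norm_odd_of_regular[OF dim v, of "x - x0"] by simp
  ultimately show "h x = busemann (\<lambda>t. x0 + t *\<^sub>R v) x"
    using le[of x] unfolding busemann_affine_ray[OF nv] by linarith
qed


section \<open>Flag-directed sequences of level 1\<close>

lemma affine_hull_ray:
  fixes c :: "real \<Rightarrow> 'a::real_normed_vector"
  assumes sc: "strictly_convex_norm TYPE('a)" and c: "is_ray c"
  shows "affine hull (c ` {0..}) = range (\<lambda>t. c 0 + t *\<^sub>R ray_direction c)"
proof (rule subset_antisym)
  let ?L = "range (\<lambda>t. c 0 + t *\<^sub>R ray_direction c)"
  have "affine ?L"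
    unfolding affine_def
  proof (clarify)
    fix a b s t :: real assume "a + b = 1"
    then have "a *\<^sub>R c 0 + b *\<^sub>R c 0 = c 0" by (simp flip: scaleR_add_left)
    then have "a *\<^sub>R (c 0 + s *\<^sub>R ray_direction c) + b *\<^sub>R (c 0 + t *\<^sub>R ray_direction c)
        = c 0 + (a * s + b * t) *\<^sub>R ray_direction c"
      by (simp add: algebra_simps)
    then show "a *\<^sub>R (c 0 + s *\<^sub>R ray_direction c) + b *\<^sub>R (c 0 + t *\<^sub>R ray_direction c) \<in> ?L"
      by blast
  qed
  then show "affine hull (c ` {0..}) \<subseteq> ?L"
    by (intro hull_minimal) (use ray_affine[OF sc c] in blast)
  have mem: "c 0 \<in> affine hull (c ` {0..})" "c 1 \<in> affine hull (c ` {0..})"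
    by (auto intro!: hull_inc)
  show "?L \<subseteq> affine hull (c ` {0..})"
  proof clarify
    fix t
    have "(1 - t) *\<^sub>R c 0 + t *\<^sub>R c 1 \<in> affine hull (c ` {0..})"
      by (intro mem_affine affine_affine_hull mem) simp
    then show "c 0 + t *\<^sub>R ray_direction c \<in> affine hull (c ` {0..})"
      by (simp add: ray_direction_def algebra_simps)
  qed
qed

lemma projection_along_line:
  fixes v :: "'a::real_vector"
  assumes f: "linear f" "f v \<noteq> 0"
  shows "projection_along (range (\<lambda>t. a + t *\<^sub>R v)) {x. f x = b} x = x + ((b - f x) / f v) *\<^sub>R v"
  unfolding projection_along_def
proof (rule the_equality)
  have "f (x + ((b - f x) / f v) *\<^sub>R v) = b"
    using f by (simp add: linear_add linear_scale)
  moreover have "x + ((b - f x) / f v) *\<^sub>R v - x = (a + ((b - f x) / f v) *\<^sub>R v) - (a + 0 *\<^sub>R v)"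
    by simp
  ultimately show "x + ((b - f x) / f v) *\<^sub>R v \<in> {x. f x = b} \<and>
    (\<exists>p\<in>range (\<lambda>t. a + t *\<^sub>R v). \<exists>q\<in>range (\<lambda>t. a + t *\<^sub>R v). x + ((b - f x) / f v) *\<^sub>R v - x = p - q)"
    by blast
  fix y
  assume y: "y \<in> {x. f x = b} \<and>
    (\<exists>p\<in>range (\<lambda>t. a + t *\<^sub>R v). \<exists>q\<in>range (\<lambda>t. a + t *\<^sub>R v). y - x = p - q)"
  then obtain s t where "y - x = s *\<^sub>R v - t *\<^sub>R v" by auto
  then have *: "y = x + (s - t) *\<^sub>R v" by (simp add: algebra_simps)
  moreover have "f y = b" using y by simp
  ultimately have "b = f x + (s - t) * f v" by (simp add: linear_add[OF f(1)] linear_scale[OF f(1)])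
  then have "s - t = (b - f x) / f v" using f(2) by simp
  then show "y = x + ((b - f x) / f v) *\<^sub>R v" using * by simp
qed

text \<open>
  Here \<open>P k\<close> is the projection to the transversal hyperplane, which converges by hypothesis.
  Dividing the decomposition of \<open>X k - x0\<close> by the distance \<open>N k\<close> of \<open>X k\<close> from \<open>x0\<close> kills
  the contribution of \<open>P k\<close>, while the quotient tends to the direction of the ray. Hence
  \<open>s k / N k\<close> tends to one; in particular \<open>s k\<close> is eventually positive and tends to infinity.
\<close>

lemma flag_directed1_decomposition:
  fixes x0 :: "'a::real_normed_vector"
  assumes sc: "strictly_convex_norm TYPE('a)" and X: "flag_directed1 x0 \<alpha> X"
  obtains P p s where "\<And>k. X k = P k + s k *\<^sub>R ray_direction \<alpha>" "P \<longlonglongrightarrow> p"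
    "filterlim s at_top sequentially"
proof -
  let ?v = "ray_direction \<alpha>"
  have \<alpha>: "is_ray \<alpha>" "\<alpha> 0 = x0"
    and inf: "filterlim (\<lambda>k. dist x0 (X k)) at_top sequentially"
    and arcs: "\<forall>K. compact K \<and> K \<subseteq> {0..} \<longrightarrow> uniform_limit K (\<lambda>k. arc_segment x0 (X k)) \<alpha> sequentially"
    using X by (auto simp: flag_directed1_def almost_flag_directed1_def)
  have nv: "norm ?v = 1" using \<alpha>(1) by (rule norm_ray_direction)
  define L where "L = range (\<lambda>t. x0 + t *\<^sub>R ?v)"
  have "affine hull (\<alpha> ` {0..}) = L"
    using affine_hull_ray[OF sc \<alpha>(1)] by (simp only: L_def \<alpha>(2))
  then obtain H where H: "is_hyperplane H" "transversal H L"
    "convergent (\<lambda>k. projection_along L H (X k))"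
    using X[unfolded flag_directed1_def Let_def, THEN conjunct2] by metis
  obtain f :: "'a \<Rightarrow> real" and b where f: "linear f" and Hf: "H = {x. f x = b}"
    using H(1) unfolding is_hyperplane_def by blast
  \<comment> \<open>Otherwise the line would be contained in the hyperplane as soon as it meets it.\<close>
  have fv: "f ?v \<noteq> 0"
  proof
    assume 0: "f ?v = 0"
    obtain z where z: "H \<inter> L = {z}" using H(2) by (auto simp: transversal_def)
    then have "z \<in> H" "z \<in> L" by blast+
    then obtain t where t: "z = x0 + t *\<^sub>R ?v" "f z = b" by (auto simp: L_def Hf)
    have "z + ?v = x0 + (t + 1) *\<^sub>R ?v" using t by (simp add: algebra_simps)
    then have "z + ?v \<in> L" unfolding L_def by blast
    moreover have "z + ?v \<in> H" using t 0 by (simp add: Hf linear_add[OF f])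
    ultimately have "z + ?v = z" using z by blast
    then show False using nv by simp
  qed
  define P where "P k = projection_along L H (X k)" for k
  define s where "s k = - ((b - f (X k)) / f ?v)" for k
  have PX: "X k = P k + s k *\<^sub>R ?v" for k
    unfolding P_def s_def L_def Hf projection_along_line[OF f fv] by simp
  obtain p where p: "P \<longlonglongrightarrow> p" using H(3) unfolding P_def[abs_def] convergent_def by blast
  define N where "N k = dist x0 (X k)" for k
  have N: "filterlim N at_top sequentially" using inf unfolding N_def[abs_def] .
  \<comment> \<open>At arc length one the segments carry all the information on the limiting direction.\<close>
  have "(\<lambda>k. arc_segment x0 (X k) 1) \<longlonglongrightarrow> \<alpha> 1"
    by (rule tendsto_uniform_limitI[OF arcs[rule_format, of "{1}"]]) auto
  then have arc1: "(\<lambda>k. arc_segment x0 (X k) 1 - x0) \<longlonglongrightarrow> ?v"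
    using tendsto_diff[OF _ tendsto_const[of x0]] \<alpha>(2) by (force simp: ray_direction_def)
  have ev: "eventually (\<lambda>k. arc_segment x0 (X k) 1 - x0 = inverse (N k) *\<^sub>R (P k - x0) + (s k / N k) *\<^sub>R ?v) sequentially"
    using N[unfolded filterlim_at_top, rule_format, of 1]
  proof eventually_elim
    case (elim k)
    have "arc_segment x0 (X k) 1 - x0 = inverse (N k) *\<^sub>R (X k - x0)"
      using elim by (simp add: arc_segment_def sgn_div_norm N_def dist_norm norm_minus_commute)
    also have "X k - x0 = (P k - x0) + s k *\<^sub>R ?v" using PX[of k] by simp
    finally show ?case by (simp add: scaleR_add_right divide_inverse mult.commute)
  qed
  have "(\<lambda>k. inverse (N k) *\<^sub>R (P k - x0)) \<longlonglongrightarrow> 0 *\<^sub>R (p - x0)"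
    by (intro tendsto_scaleR tendsto_diff tendsto_const p tendsto_inverse_0_at_top N)
  then have small: "(\<lambda>k. inverse (N k) *\<^sub>R (P k - x0)) \<longlonglongrightarrow> 0" by simp
  have "(\<lambda>k. inverse (N k) *\<^sub>R (P k - x0) + (s k / N k) *\<^sub>R ?v) \<longlonglongrightarrow> ?v"
    using Lim_transform_eventually[OF arc1 ev] .
  from tendsto_diff[OF this small] have "(\<lambda>k. (s k / N k) *\<^sub>R ?v) \<longlonglongrightarrow> ?v" by simp
  then have "(\<lambda>k. norm ((s k / N k) *\<^sub>R ?v - ?v)) \<longlonglongrightarrow> 0"
    by (intro tendsto_norm_zero) (simp add: LIM_zero_iff)
  moreover have "norm ((s k / N k) *\<^sub>R ?v - ?v) = \<bar>s k / N k - 1\<bar>" for k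
  proof -
    have "(s k / N k) *\<^sub>R ?v - ?v = (s k / N k - 1) *\<^sub>R ?v" by (simp add: scaleR_left_diff_distrib)
    then show ?thesis using nv by simp
  qed
  ultimately have ratio: "(\<lambda>k. s k / N k) \<longlonglongrightarrow> 1"
    by (simp add: tendsto_rabs_zero_iff LIM_zero_iff)
  have "filterlim (\<lambda>k. (s k / N k) * N k) at_top sequentially"
    by (rule filterlim_tendsto_pos_mult_at_top[OF ratio _ N]) simp
  moreover have "eventually (\<lambda>k. (s k / N k) * N k = s k) sequentially"
    using N[unfolded filterlim_at_top_dense, rule_format, of 0] by eventually_elim simp
  ultimately have "filterlim s at_top sequentially"
    by (subst (asm) filterlim_cong[OF refl refl])
  with PX p show ?thesis by (rule that)
qed

lemma limiting_horofunction_flag_directed1: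
  fixes x0 :: "'a::real_normed_vector"
  assumes sc: "strictly_convex_norm TYPE('a)" and X: "flag_directed1 x0 \<alpha> X"
    and h: "is_limiting_horofunction x0 X h"
  shows "\<exists>c a. is_ray c \<and> (\<forall>x. busemann c x = h x + a)"
proof -
  let ?v = "ray_direction \<alpha>"
  have "is_ray \<alpha>" using X by (simp add: flag_directed1_def almost_flag_directed1_def)
  then have nv: "norm ?v = 1" by (rule norm_ray_direction)
  obtain P p s where PX: "\<And>k. X k = P k + s k *\<^sub>R ?v" and P: "P \<longlonglongrightarrow> p"
    and s: "filterlim s at_top sequentially"
    using flag_directed1_decomposition[OF sc X] by metis
  let ?c = "\<lambda>t. p + t *\<^sub>R ?v"
  have lim: "(\<lambda>k. dist x (X k) - s k) \<longlonglongrightarrow> busemann ?c x" for x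
  proof -
    have "(\<lambda>k. dist x (p + s k *\<^sub>R ?v) - s k) \<longlonglongrightarrow> busemann ?c x"
      using filterlim_compose[OF busemann_tendsto[OF nv] s] by (simp add: busemann_affine_ray[OF nv])
    moreover have "(\<lambda>k. dist x (X k) - dist x (p + s k *\<^sub>R ?v)) \<longlonglongrightarrow> 0"
    proof (rule Lim_null_comparison)
      have "norm (dist x (X k) - dist x (p + s k *\<^sub>R ?v)) \<le> dist (P k) p" for k
      proof -
        have "dist (X k) (p + s k *\<^sub>R ?v) = dist (P k) p" using PX by (simp add: dist_norm)
        then show ?thesis
          using abs_dist_diff_le[of "X k" x "p + s k *\<^sub>R ?v"] by (simp add: dist_commute)
      qed
      then show "eventually (\<lambda>k. norm (dist x (X k) - dist x (p + s k *\<^sub>R ?v)) \<le> dist (P k) p) sequentially"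
        by simp
      show "(\<lambda>k. dist (P k) p) \<longlonglongrightarrow> 0" using P by (rule tendsto_dist_iff[THEN iffD1])
    qed
    ultimately show ?thesis using tendsto_add by force
  qed
  have "busemann ?c x = h x + busemann ?c x0" for x
  proof -
    have "(\<lambda>k. dist_fun x0 (X k) x) \<longlonglongrightarrow> h x"
      using h unfolding is_limiting_horofunction_def by (rule limitin_cont_topology_pointwise)
    moreover have "(\<lambda>k. dist_fun x0 (X k) x) \<longlonglongrightarrow> busemann ?c x - busemann ?c x0"
      using tendsto_diff[OF lim[of x] lim[of x0]] by (simp add: dist_fun_def)
    ultimately have "h x = busemann ?c x - busemann ?c x0" by (rule LIMSEQ_unique)
    then show ?thesis by simp
  qed
  then show ?thesis using is_ray_affine[OF nv] by blast
qed

theorem theorem0p2: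
  fixes x0 :: "'a::real_normed_vector" and n :: nat and \<Phi> :: "('a \<Rightarrow> real) set"
  assumes "singular_minkowski_space TYPE('a) n"
    and "\<Phi> \<in> coarse_boundary x0"
  shows "(regular_direction (weak_direction (Pr x0 \<Phi>))
            \<longrightarrow> (\<exists>c. is_ray c \<and> busemann c \<in> \<Phi>))
       \<and> ((\<exists>X \<alpha> h. flag_directed1 x0 \<alpha> X \<and> singular_direction (ray_direction \<alpha>)
               \<and> is_limiting_horofunction x0 X h \<and> h \<in> \<Phi>)
            \<longrightarrow> (\<exists>c. is_ray c \<and> busemann c \<in> \<Phi>))"
proof -
  have dim: "has_dimension TYPE('a) n" and sc: "strictly_convex_norm TYPE('a)"
    using assms(1) by (auto simp: singular_minkowski_space_def)
  obtain h Y where h: "h \<in> cont_funs" "\<Phi> = coarse_class h" and Y: "horofunction_along x0 Y h"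
    using coarse_boundary_horofunction[OF dim assms(2)] by metis
  obtain v where v: "norm v = 1" "\<And>t. 0 \<le> t \<Longrightarrow> h (x0 + t *\<^sub>R v) = - t"
    using horofunction_descent_direction[OF dim Y] by metis
  let ?c = "\<lambda>t. x0 + t *\<^sub>R v"
  have "Pr x0 \<Phi> = weak_rel `` {?c}"
    unfolding h(2)
    by (intro Pr_eq_weak_class h(1) horofunction_base[OF Y] minimizing_ray_horofunction[OF sc Y v])
  then have dir: "weak_direction (Pr x0 \<Phi>) = v"
    using weak_direction_weak_class[OF sc is_ray_affine[OF v(1)]] by (simp add: ray_direction_def)
  have "\<exists>c. is_ray c \<and> busemann c \<in> \<Phi>" if "regular_direction v"
  proof (intro exI conjI)
    show "is_ray ?c" using v(1) by (rule is_ray_affine)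
    have "busemann ?c = h"
      using horofunction_eq_busemann_of_regular[OF dim Y that v(2)] by simp
    then show "busemann ?c \<in> \<Phi>"
      unfolding h(2) mem_coarse_class_iff[OF h(1)] by (intro exI[of _ 0]) simp
  qed
  moreover have "\<exists>c. is_ray c \<and> busemann c \<in> \<Phi>"
    if X: "flag_directed1 x0 \<alpha> X" "is_limiting_horofunction x0 X g" "g \<in> \<Phi>" for X \<alpha> g
  proof -
    have "g \<in> cont_funs" "\<Phi> = coarse_class g"
      using coarse_class_eq[OF h(1)] X(3) h(2) by auto
    then show ?thesis
      using limiting_horofunction_flag_directed1[OF sc X(1,2)] mem_coarse_class_iff by blast
  qed
  ultimately show ?thesis unfolding dir by blast
qed

end
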